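(* Let $\gamma>0$, $\beta\ge 0$, $p\in[0,1]$ be constants and consider the finite difference scheme: find a grid function $U$ with $$\widehat H_{\mathbf h}[U_\alpha]=0 \ \text{ if } \mathbf x_\alpha\in\mathcal T_{\mathbf h}\cap\Omega,\qquad U_\alpha=g(\mathbf x_\alpha)\ \text{ if } \mathbf x_\alpha\in\mathcal T_{\mathbf h}\cap\partial\Omega,\qquad B_{\mathbf h}U_\alpha=0\ \text{ if }\mathbf x_\alpha\in\mathcal S_{h_i},$$ where $$\widehat H_{\mathbf h}[U_\alpha]=-\beta h^2\Delta_{\mathbf h}U_\alpha+H(\nabla_{\mathbf h}U_\alpha,U_\alpha,\mathbf x_\alpha)+\theta U_\alpha+\gamma h^p(\Delta_{2\mathbf h}-\Delta_{\mathbf h})U_\alpha ,$$ for the Hamilton-Jacobi problem $H(\nabla u,u,\mathbf x)+\theta u=0$ in $\Omega$, $u=g$ on $\partial\Omega$. Then: (i) the scheme has second order local truncation error over the interior grid $\mathring{\mathcal T}_{\mathbf h}$; (ii) with the auxiliary boundary operator $B_{\mathbf h}U_\alpha=-\delta^2_{x_i,h_i}U_\alpha$, the scheme has local truncation error $\mathcal O(h^p)$ over $(\mathcal T_{\mathbf h}\cap\Omega)\setminus\mathring{\mathcal T}_{\mathbf h}$; (iii) with the auxiliary boundary operator $B_{\mathbf h}U_\alpha=-\delta^2_{x_i,h_i}U_\alpha+\delta^2_{x_i,h_i}U_{\alpha'}$, where $\mathbf x_{\alpha'}\in\{\mathbf x_\alpha-h_i\mathbf e_i,\mathbf x_\alpha+h_i\mathbf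 e_i\}$ is the neighbor lying in $\mathcal T_{\mathbf h}\cap\Omega$, the scheme has local truncation error $\mathcal O(h^{p+1})$ over $(\mathcal T_{\mathbf h}\cap\Omega)\setminus\mathring{\mathcal T}_{\mathbf h}$.
   Context: Setting: $\Omega=(a_1,b_1)\times\cdots\times(a_d,b_d)$; $\theta>0$ is constant; $g$ is continuous on $\partial\Omega$; $H:\mathbb R^d\times\mathbb R\times\overline\Omega\to\mathbb R$, $(\mathbf q,u,\mathbf x)\mapsto H(\mathbf q,u,\mathbf x)$, is locally Lipschitz and nondecreasing in $u$. Grid: for integers $J_i\ge 2$ let $h_i=(b_i-a_i)/(J_i-1)$, $\mathbf h=(h_1,\dots,h_d)$, $h=\max_i h_i$. For $\alpha=(\alpha_1,\dots,\alpha_d)$ with $1\le\alpha_i\le J_i$, $\mathbf x_\alpha=(a_1+(\alpha_1-1)h_1,\dots,a_d+(\alpha_d-1)h_d)$, and $\mathcal T_{\mathbf h}$ is the set of all these $\mathbf x_\alpha$. $\mathbf e_i$ are the canonical basis vectors. The interior grid is $\mathring{\mathcal T}_{\mathbf h}=\{\mathbf x_\alpha\in\mathcal T_{\mathbf h}\cap\Omega: \mathbf x_{\alpha\pm\mathbf e_i}\notin\partial\Omega \text{ for all } i\}$. Also $\mathcal S_{h_i}=\{\mathbf x_\alpha\in\mathcal T_{\mathbf h}\cap\partial\Omega:\ \mathbf x_\alpha+h_i\mathbf e_i\in\mathcal T_{\mathbf h}\cap\Omega\text{ or }\mathbf x_\alpha-h_i\mathbf e_i\in\mathcal T_{\mathbf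 h}\cap\Omega\}$ for $i=1,\dots,d$. Difference operators: $\delta_{x_i,h_i}V_\alpha=\frac{V_{\alpha+\mathbf e_i}-V_{\alpha-\mathbf e_i}}{2h_i}$, $\nabla_{\mathbf h}=[\delta_{x_1,h_1},\dots,\delta_{x_d,h_d}]^T$, $\delta^2_{x_i,h_i}V_\alpha=\frac{V_{\alpha+\mathbf e_i}-2V_\alpha+V_{\alpha-\mathbf e_i}}{h_i^2}$, $\delta^2_{x_i,2h_i}V_\alpha=\frac{V_{\alpha+2\mathbf e_i}-2V_\alpha+V_{\alpha-2\mathbf e_i}}{4h_i^2}$, $\Delta_{\mathbf h}=\sum_i\delta^2_{x_i,h_i}$, $\Delta_{2\mathbf h}=\sum_i\delta^2_{x_i,2h_i}$. When $\mathbf x_\alpha\in\Omega$ is adjacent to $\partial\Omega$ in direction $\pm\mathbf e_i$, the value at $\alpha\pm2\mathbf e_i$ is a ghost value (outside $\overline\Omega$), which is determined from the grid values by the auxiliary boundary condition $B_{\mathbf h}U_{\alpha\pm\mathbf e_i}=0$ at the boundary node $\mathbf x_{\alpha\pm\mathbf e_i}\in\mathcal S_{h_i}$. Local truncation error: for a sufficiently smooth function $u$ (namely $u\in C^5(\overline\Omega)$) with $u=g$ on $\partial\Omega$, insert the grid values $u(\mathbf x_\alpha)$ into $\widehat H_{\mathbf h}$, with ghost values determined from the grid values of $u$ by $B_{\mathbf h}=0$. The local truncation error at $\mathbf x_\alpha\in\mathcal T_{\mathbf h}\cap\Omega$ is $\widehat H_{\mathbf h}[u(\mathbf x_\alpha)]-\big(H(\nabla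 u(\mathbf x_\alpha),u(\mathbf x_\alpha),\mathbf x_\alpha)+\theta u(\mathbf x_\alpha)\big)$. It is $\mathcal O(h^q)$ over a set of nodes if it is bounded in absolute value by $Ch^q$ at all those nodes as $h\to0$ with $C$ independent of $\mathbf h$ and of the node; second order means $\mathcal O(h^2)$. *)

theory Defs
  imports "HOL-Analysis.Analysis"
begin

text \<open>\<open>C_closure k S f\<close> for open \<open>S\<close> is \<open>f \<in> C\<^sup>k(closure S)\<close>: all partial derivatives of order at
  most \<open>k\<close> exist in \<open>S\<close> and extend continuously to \<open>closure S\<close>. The functions \<open>g i\<close> below are these
  extensions of the first partial derivatives of \<open>f\<close>.\<close>

primrec C_closure :: "nat \<Rightarrow> (real ^ 'n::finite) set \<Rightarrow> (real ^ 'n \<Rightarrow> real) \<Rightarrow> bool" where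
  "C_closure 0 S f \<longleftrightarrow> continuous_on (closure S) f"
| "C_closure (Suc k) S f \<longleftrightarrow> continuous_on (closure S) f \<and>
     (\<exists>g :: 'n \<Rightarrow> real ^ 'n \<Rightarrow> real. \<forall>i. C_closure k S (g i) \<and>
        (\<forall>x\<in>S. ((\<lambda>t. f (x + t *\<^sub>R axis i 1)) has_real_derivative g i x) (at 0)))"

definition grad :: "(real ^ 'n::finite \<Rightarrow> real) \<Rightarrow> real ^ 'n \<Rightarrow> real ^ 'n" where
  "grad u x = (\<chi> i. deriv (\<lambda>t. u (x + t *\<^sub>R axis i 1)) 0)"

definition locally_lipschitz_on :: "'a::metric_space set \<Rightarrow> ('a \<Rightarrow> 'b::metric_space) \<Rightarrow> bool" where
  "locally_lipschitz_on S f \<longleftrightarrow> (\<forall>x\<in>S. \<exists>r>0. \<exists>L. L-lipschitz_on (ball x r \<inter> S) f)"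

text \<open>The domain is \<open>box a b\<close>. Multi-indices are integer valued, and a grid function is defined on all
  of them, so that it also carries the ghost values: \<open>node\<close> maps indices outside \<open>grid_idx\<close>
  to points outside the closed box. As \<open>node\<close> is injective, sets of nodes are given as sets of
  multi-indices.\<close>

type_synonym 'n idx = "'n \<Rightarrow> int"
type_synonym 'n gridfun = "'n idx \<Rightarrow> real"

definition step :: "real ^ 'n::finite \<Rightarrow> real ^ 'n \<Rightarrow> ('n \<Rightarrow> nat) \<Rightarrow> 'n \<Rightarrow> real" where
  "step a b J i = (b $ i - a $ i) / (real (J i) - 1)"

definition mesh :: "real ^ 'n::finite \<Rightarrow> real ^ 'n \<Rightarrow> ('n \<Rightarrow> nat) \<Rightarrow> real" where
  "mesh a b J = Max (range (step a b J))"

definition node :: "real ^ 'n::finite \<Rightarrow> real ^ 'n \<Rightarrow> ('n \<Rightarrow> nat) \<Rightarrow> 'n idx \<Rightarrow> real ^ 'n" where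
  "node a b J \<alpha> = (\<chi> i. a $ i + (real_of_int (\<alpha> i) - 1) * step a b J i)"

definition grid_idx :: "('n \<Rightarrow> nat) \<Rightarrow> 'n idx set" where
  "grid_idx J = {\<alpha>. \<forall>i. 1 \<le> \<alpha> i \<and> \<alpha> i \<le> int (J i)}"

text \<open>\<open>shift i k \<alpha>\<close> is \<open>\<alpha> + k e\<^sub>i\<close>.\<close>

definition shift :: "'n \<Rightarrow> int \<Rightarrow> 'n idx \<Rightarrow> 'n idx" where
  "shift i k \<alpha> = \<alpha>(i := \<alpha> i + k)"

definition inner_nodes :: "real ^ 'n::finite \<Rightarrow> real ^ 'n \<Rightarrow> ('n \<Rightarrow> nat) \<Rightarrow> 'n idx set" where
  "inner_nodes a b J = {\<alpha> \<in> grid_idx J. node a b J \<alpha> \<in> box a b}"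

definition interior_grid :: "real ^ 'n::finite \<Rightarrow> real ^ 'n \<Rightarrow> ('n \<Rightarrow> nat) \<Rightarrow> 'n idx set" where
  "interior_grid a b J = {\<alpha> \<in> inner_nodes a b J.
     \<forall>i. node a b J (shift i 1 \<alpha>) \<notin> frontier (box a b) \<and>
         node a b J (shift i (-1) \<alpha>) \<notin> frontier (box a b)}"

definition bdry_nodes :: "real ^ 'n::finite \<Rightarrow> real ^ 'n \<Rightarrow> ('n \<Rightarrow> nat) \<Rightarrow> 'n \<Rightarrow> 'n idx set" where
  "bdry_nodes a b J i = {\<alpha> \<in> grid_idx J. node a b J \<alpha> \<in> frontier (box a b) \<and>
     (shift i 1 \<alpha> \<in> inner_nodes a b J \<or> shift i (-1) \<alpha> \<in> inner_nodes a b J)}"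

definition diff1 :: "real \<Rightarrow> 'n \<Rightarrow> 'n gridfun \<Rightarrow> 'n gridfun" where
  "diff1 h i V \<alpha> = (V (shift i 1 \<alpha>) - V (shift i (-1) \<alpha>)) / (2 * h)"

definition diff2 :: "real \<Rightarrow> 'n \<Rightarrow> 'n gridfun \<Rightarrow> 'n gridfun" where
  "diff2 h i V \<alpha> = (V (shift i 1 \<alpha>) - 2 * V \<alpha> + V (shift i (-1) \<alpha>)) / h\<^sup>2"

definition diff2_wide :: "real \<Rightarrow> 'n \<Rightarrow> 'n gridfun \<Rightarrow> 'n gridfun" where
  "diff2_wide h i V \<alpha> = (V (shift i 2 \<alpha>) - 2 * V \<alpha> + V (shift i (-2) \<alpha>)) / (4 * h\<^sup>2)"

definition grad_h :: "('n::finite \<Rightarrow> real) \<Rightarrow> 'n gridfun \<Rightarrow> 'n idx \<Rightarrow> real ^ 'n" where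
  "grad_h hs V \<alpha> = (\<chi> i. diff1 (hs i) i V \<alpha>)"

definition lap :: "('n::finite \<Rightarrow> real) \<Rightarrow> 'n gridfun \<Rightarrow> 'n gridfun" where
  "lap hs V \<alpha> = (\<Sum>i\<in>UNIV. diff2 (hs i) i V \<alpha>)"

definition lap_wide :: "('n::finite \<Rightarrow> real) \<Rightarrow> 'n gridfun \<Rightarrow> 'n gridfun" where
  "lap_wide hs V \<alpha> = (\<Sum>i\<in>UNIV. diff2_wide (hs i) i V \<alpha>)"

type_synonym 'n hamiltonian = "real ^ 'n \<Rightarrow> real \<Rightarrow> real ^ 'n \<Rightarrow> real"

definition H_hat :: "real \<Rightarrow> real \<Rightarrow> real \<Rightarrow> real \<Rightarrow> 'n::finite hamiltonian \<Rightarrow>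
    real ^ 'n \<Rightarrow> real ^ 'n \<Rightarrow> ('n \<Rightarrow> nat) \<Rightarrow> 'n gridfun \<Rightarrow> 'n gridfun" where
  "H_hat \<beta> \<gamma> p \<theta> H a b J V \<alpha> =
     - \<beta> * (mesh a b J)\<^sup>2 * lap (step a b J) V \<alpha>
     + H (grad_h (step a b J) V \<alpha>) (V \<alpha>) (node a b J \<alpha>)
     + \<theta> * V \<alpha>
     + \<gamma> * mesh a b J powr p * (lap_wide (step a b J) V \<alpha> - lap (step a b J) V \<alpha>)"

text \<open>For a grid given by \<open>J\<close>, an auxiliary boundary operator \<open>B J i\<close> is to be evaluated at the nodes in
  \<open>bdry_nodes a b J i\<close>.\<close>

type_synonym 'n bdry_op = "('n \<Rightarrow> nat) \<Rightarrow> 'n \<Rightarrow> 'n gridfun \<Rightarrow> 'n gridfun"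

definition B_lin :: "real ^ 'n::finite \<Rightarrow> real ^ 'n \<Rightarrow> 'n bdry_op" where
  "B_lin a b J i V \<alpha> = - diff2 (step a b J i) i V \<alpha>"

definition inner_nbr :: "real ^ 'n::finite \<Rightarrow> real ^ 'n \<Rightarrow> ('n \<Rightarrow> nat) \<Rightarrow> 'n \<Rightarrow> 'n idx \<Rightarrow> 'n idx" where
  "inner_nbr a b J i \<alpha> =
     (THE \<alpha>'. \<alpha>' \<in> {shift i (-1) \<alpha>, shift i 1 \<alpha>} \<and> \<alpha>' \<in> inner_nodes a b J)"

definition B_quad :: "real ^ 'n::finite \<Rightarrow> real ^ 'n \<Rightarrow> 'n bdry_op" where
  "B_quad a b J i V \<alpha> =
     - diff2 (step a b J i) i V \<alpha> + diff2 (step a b J i) i V (inner_nbr a b J i \<alpha>)"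

text \<open>\<open>V\<close> consists of the grid values of \<open>u\<close> together with ghost values determined by \<open>B = 0\<close>.
  Such a \<open>V\<close> is not unique, but for \<open>B_lin\<close> and \<open>B_quad\<close> it exists (lemma \<open>inserted_exists\<close>) and all values of \<open>V\<close> that enter
  \<open>H_hat\<close> at inner nodes are determined.\<close>

definition inserted :: "real ^ 'n::finite \<Rightarrow> real ^ 'n \<Rightarrow> ('n \<Rightarrow> nat) \<Rightarrow> 'n bdry_op \<Rightarrow>
    (real ^ 'n \<Rightarrow> real) \<Rightarrow> 'n gridfun \<Rightarrow> bool" where
  "inserted a b J B u V \<longleftrightarrow>
     (\<forall>\<alpha>\<in>grid_idx J. V \<alpha> = u (node a b J \<alpha>)) \<and>
     (\<forall>i. \<forall>\<alpha>\<in>bdry_nodes a b J i. B J i V \<alpha> = 0)"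

definition trunc_err :: "real \<Rightarrow> real \<Rightarrow> real \<Rightarrow> real \<Rightarrow> 'n::finite hamiltonian \<Rightarrow>
    real ^ 'n \<Rightarrow> real ^ 'n \<Rightarrow> ('n \<Rightarrow> nat) \<Rightarrow> (real ^ 'n \<Rightarrow> real) \<Rightarrow> 'n gridfun \<Rightarrow> 'n gridfun" where
  "trunc_err \<beta> \<gamma> p \<theta> H a b J u V \<alpha> =
     H_hat \<beta> \<gamma> p \<theta> H a b J V \<alpha>
     - (let x = node a b J \<alpha> in H (grad u x) (u x) x + \<theta> * u x)"

text \<open>The error is \<open>O(h\<^sup>q)\<close> over the node sets \<open>N J\<close> as \<open>h = mesh a b J\<close> tends to \<open>0\<close>, for the scheme
  with auxiliary boundary operator \<open>B\<close>.\<close>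

definition trunc_err_order :: "real \<Rightarrow> real \<Rightarrow> real \<Rightarrow> real \<Rightarrow> 'n::finite hamiltonian \<Rightarrow>
    real ^ 'n \<Rightarrow> real ^ 'n \<Rightarrow> 'n bdry_op \<Rightarrow> (real ^ 'n \<Rightarrow> real) \<Rightarrow>
    (('n \<Rightarrow> nat) \<Rightarrow> 'n idx set) \<Rightarrow> real \<Rightarrow> bool" where
  "trunc_err_order \<beta> \<gamma> p \<theta> H a b B u N q \<longleftrightarrow>
     (\<exists>C. \<exists>h0>0. \<forall>J V. (\<forall>i. 2 \<le> J i) \<longrightarrow> mesh a b J < h0 \<longrightarrow> inserted a b J B u V \<longrightarrow>
        (\<forall>\<alpha>\<in>N J. \<bar>trunc_err \<beta> \<gamma> p \<theta> H a b J u V \<alpha>\<bar> \<le> C * mesh a b J powr q))"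

lemma node_in_box:
  assumes "\<And>i. a $ i < b $ i" "\<And>i. 2 \<le> J i"
  shows "node a b J \<alpha> \<in> box a b \<longleftrightarrow> (\<forall>i. 1 < \<alpha> i \<and> \<alpha> i < int (J i))"
proof -
  have "(a $ i < node a b J \<alpha> $ i \<longleftrightarrow> 1 < \<alpha> i) \<and> (node a b J \<alpha> $ i < b $ i \<longleftrightarrow> \<alpha> i < int (J i))" for i
  proof -
    have s: "step a b J i > 0" using assms[of i] by (simp add: step_def)
    have J: "real (J i) - 1 > 0" using assms(2)[of i] by simp
    have "b $ i = a $ i + (real (J i) - 1) * step a b J i" using J by (simp add: step_def)
    hence "node a b J \<alpha> $ i < b $ i \<longleftrightarrow> (real_of_int (\<alpha> i) - 1) * step a b J i < (real (J i) - 1) * step a b J i"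
      by (simp add: node_def)
    also have "\<dots> \<longleftrightarrow> real_of_int (\<alpha> i) < real_of_int (int (J i))" using s by simp
    also have "\<dots> \<longleftrightarrow> \<alpha> i < int (J i)" by linarith
    finally show ?thesis using s by (simp add: node_def zero_less_mult_iff)
  qed
  thus ?thesis by (simp add: mem_box_cart)
qed

lemma bdry_nodeD:
  assumes ab: "\<And>i. a $ i < b $ i" "\<And>i. 2 \<le> J i" and \<beta>: "\<beta> \<in> bdry_nodes a b J i"
  obtains s where "s = 1 \<or> s = -1" "shift i s \<beta> \<in> inner_nodes a b J" "inner_nbr a b J i \<beta> = shift i s \<beta>"
    "(s = 1 \<and> \<beta> i = 1) \<or> (s = -1 \<and> \<beta> i = int (J i))" "3 \<le> J i"
    "\<And>j. j \<noteq> i \<Longrightarrow> 1 < \<beta> j \<and> \<beta> j < int (J j)"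
proof -
  have inn: "\<gamma> \<in> inner_nodes a b J \<longleftrightarrow> (\<forall>j. 1 < \<gamma> j \<and> \<gamma> j < int (J j))" for \<gamma>
    using node_in_box[where a=a and b=b and J=J, OF ab, where \<alpha>=\<gamma>] by (auto simp: inner_nodes_def grid_idx_def less_imp_le)
  have nb: "\<not> (\<forall>j. 1 < \<beta> j \<and> \<beta> j < int (J j))"
    using \<beta> node_in_box[where a=a and b=b and J=J, OF ab, where \<alpha>=\<beta>] by (auto simp: bdry_nodes_def frontier_def interior_open[OF open_box])
  have g: "1 \<le> \<beta> i" "\<beta> i \<le> int (J i)" using \<beta> by (auto simp: bdry_nodes_def grid_idx_def)
  obtain s where s: "s = 1 \<or> s = -1" "shift i s \<beta> \<in> inner_nodes a b J"
    using \<beta> by (auto simp: bdry_nodes_def)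
  have j: "1 < \<beta> j \<and> \<beta> j < int (J j)" if "j \<noteq> i" for j
    using s(2) that unfolding inn by (auto simp: shift_def dest: spec[of _ j])
  have bi: "\<not> (1 < \<beta> i \<and> \<beta> i < int (J i))" using nb j by metis
  have si: "1 < \<beta> i + s" "\<beta> i + s < int (J i)" using s(2) by (auto simp: inn shift_def dest: spec[of _ i])
  have c: "(s = 1 \<and> \<beta> i = 1) \<or> (s = -1 \<and> \<beta> i = int (J i))" using s(1) si bi g by linarith
  have J3: "3 \<le> J i" using c si by auto
  have no: "shift i (-s) \<beta> \<notin> inner_nodes a b J"
  proof
    assume "shift i (-s) \<beta> \<in> inner_nodes a b J"
    hence "1 < \<beta> i - s \<and> \<beta> i - s < int (J i)" by (auto simp: inn shift_def dest: spec[of _ i])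
    thus False using c by auto
  qed
  have "inner_nbr a b J i \<beta> = shift i s \<beta>" unfolding inner_nbr_def
    using s no by (intro the_equality) auto
  from that[OF s this c J3 j] show ?thesis by blast
qed

lemma ghost:
  assumes ab: "\<And>i. a $ i < b $ i" "\<And>i. 2 \<le> J i"
  fixes ka kb kc :: real and U :: "'n::finite gridfun"
  obtains V where "\<And>\<alpha>. \<alpha> \<in> grid_idx J \<Longrightarrow> V \<alpha> = U \<alpha>"
   "\<And>i \<beta> s. \<beta> \<in> bdry_nodes a b J i \<Longrightarrow> s = 1 \<or> s = -1 \<Longrightarrow> shift i s \<beta> \<in> inner_nodes a b J \<Longrightarrow>
      V (shift i (-s) \<beta>) = ka * V \<beta> + kb * V (shift i s \<beta>) + kc * V (shift i (2 * s) \<beta>)"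
proof -
  define out where "out = (\<lambda>(\<gamma>::'n idx) i. \<gamma> i < 1 \<or> \<gamma> i > int (J i))"
  define V where "V \<gamma> = (if \<gamma> \<in> grid_idx J then U \<gamma> else
     let i = SOME i. out \<gamma> i; s = (if \<gamma> i < 1 then 1 else -1) in
     ka * U (shift i s \<gamma>) + kb * U (shift i (2 * s) \<gamma>) + kc * U (shift i (3 * s) \<gamma>))" for \<gamma>
  have *: "V (shift i (-s) \<beta>) = ka * V \<beta> + kb * V (shift i s \<beta>) + kc * V (shift i (2 * s) \<beta>)"
    if \<beta>: "\<beta> \<in> bdry_nodes a b J i" and s: "s = 1 \<or> s = -1" "shift i s \<beta> \<in> inner_nodes a b J" for i \<beta> s
  proof -
    obtain s' where s': "s' = 1 \<or> s' = -1" "shift i s' \<beta> \<in> inner_nodes a b J"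
      "inner_nbr a b J i \<beta> = shift i s' \<beta>"
    and cc: "(s' = 1 \<and> \<beta> i = 1) \<or> (s' = -1 \<and> \<beta> i = int (J i))" "3 \<le> J i"
    and j: "\<And>j. j \<noteq> i \<Longrightarrow> 1 < \<beta> j \<and> \<beta> j < int (J j)"
      using bdry_nodeD[where a=a and b=b and J=J, OF ab \<beta>] by metis
    have "1 \<le> \<beta> i + s" "\<beta> i + s \<le> int (J i)" using s(2) by (auto simp: inner_nodes_def grid_idx_def shift_def dest: spec[of _ i])
    hence ss: "s' = s" using s cc by auto
    define \<gamma> where "\<gamma> = shift i (-s) \<beta>"
    have o: "out \<gamma> k \<longleftrightarrow> k = i" for k
      using cc ss j[of k] by (cases "k = i") (auto simp: out_def \<gamma>_def shift_def)
    have si: "(SOME k. out \<gamma> k) = i" using o by simp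
    have ng: "\<gamma> \<notin> grid_idx J"
    proof assume "\<gamma> \<in> grid_idx J" hence "1 \<le> \<gamma> i \<and> \<gamma> i \<le> int (J i)" by (simp add: grid_idx_def) thus False using o[of i] by (auto simp: out_def) qed
    have sg: "(if \<gamma> i < 1 then 1 else -1) = s" using cc ss by (auto simp: \<gamma>_def shift_def)
    have sh: "shift i s \<gamma> = \<beta>" "shift i (2 * s) \<gamma> = shift i s \<beta>" "shift i (3 * s) \<gamma> = shift i (2 * s) \<beta>"
      by (auto simp: \<gamma>_def shift_def)
    have gr: "\<beta> \<in> grid_idx J" "shift i s \<beta> \<in> grid_idx J" using \<beta> s by (auto simp: bdry_nodes_def inner_nodes_def)
    have gr3: "shift i (2 * s) \<beta> \<in> grid_idx J"
      unfolding grid_idx_def using cc ss j by (auto simp: shift_def less_imp_le)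
    have "V \<gamma> = ka * U \<beta> + kb * U (shift i s \<beta>) + kc * U (shift i (2 * s) \<beta>)"
      using ng unfolding V_def by (simp add: si Let_def sg sh)
    thus ?thesis using gr gr3 by (simp add: V_def \<gamma>_def)
  qed
  show ?thesis by (rule that[of V]) (use * in \<open>auto simp: V_def\<close>)
qed

lemma inserted_exists:
  assumes ab: "\<And>i. a $ i < b $ i" "\<And>i. 2 \<le> J i"
  shows "\<exists>V. inserted a b J (B_lin a b) u V" and "\<exists>V. inserted a b J (B_quad a b) u V"
proof -
  have sh: "shift i k (shift i l \<beta>) = shift i (k + l) \<beta>" "shift i 0 \<beta> = \<beta>" for i k l and \<beta> :: "'a idx"
    by (auto simp: shift_def)
  show "\<exists>V. inserted a b J (B_lin a b) u V"
  proof (rule ghost[where a=a and b=b and J=J and U="\<lambda>\<alpha>. u (node a b J \<alpha>)" and ka="2" and kb="-1" and kc="0", OF ab])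
    fix V :: "'a gridfun"
    assume V: "\<And>\<alpha>. \<alpha> \<in> grid_idx J \<Longrightarrow> V \<alpha> = u (node a b J \<alpha>)"
      and g: "\<And>i \<beta> s. \<beta> \<in> bdry_nodes a b J i \<Longrightarrow> s = 1 \<or> s = -1 \<Longrightarrow> shift i s \<beta> \<in> inner_nodes a b J \<Longrightarrow>
        V (shift i (-s) \<beta>) = 2 * V \<beta> + (-1) * V (shift i s \<beta>) + 0 * V (shift i (2 * s) \<beta>)"
    have "B_lin a b J i V \<beta> = 0" if \<beta>: "\<beta> \<in> bdry_nodes a b J i" for i \<beta>
    proof -
      obtain s where s: "s = 1 \<or> s = -1" "shift i s \<beta> \<in> inner_nodes a b J"
        using \<beta> by (auto simp: bdry_nodes_def)
      have "V (shift i (-s) \<beta>) = 2 * V \<beta> - V (shift i s \<beta>)" using g[OF \<beta> s] by simp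
      thus ?thesis using s(1) by (elim disjE) (simp_all add: B_lin_def diff2_def)
    qed
    with V show ?thesis unfolding inserted_def by blast
  qed
  show "\<exists>V. inserted a b J (B_quad a b) u V"
  proof (rule ghost[where a=a and b=b and J=J and U="\<lambda>\<alpha>. u (node a b J \<alpha>)" and ka="3" and kb="-3" and kc="1", OF ab])
    fix V :: "'a gridfun"
    assume V: "\<And>\<alpha>. \<alpha> \<in> grid_idx J \<Longrightarrow> V \<alpha> = u (node a b J \<alpha>)"
      and g: "\<And>i \<beta> s. \<beta> \<in> bdry_nodes a b J i \<Longrightarrow> s = 1 \<or> s = -1 \<Longrightarrow> shift i s \<beta> \<in> inner_nodes a b J \<Longrightarrow>
        V (shift i (-s) \<beta>) = 3 * V \<beta> + (-3) * V (shift i s \<beta>) + 1 * V (shift i (2 * s) \<beta>)"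
    have "B_quad a b J i V \<beta> = 0" if \<beta>: "\<beta> \<in> bdry_nodes a b J i" for i \<beta>
    proof -
      obtain s where s: "s = 1 \<or> s = -1" "shift i s \<beta> \<in> inner_nodes a b J"
          "inner_nbr a b J i \<beta> = shift i s \<beta>"
        using bdry_nodeD[where a=a and b=b and J=J, OF ab \<beta>] by metis
      have e: "V (shift i (-s) \<beta>) = 3 * V \<beta> - 3 * V (shift i s \<beta>) + V (shift i (2 * s) \<beta>)"
        using g[OF \<beta> s(1,2)] by simp
      have "diff2 (step a b J i) i V \<beta> = diff2 (step a b J i) i V (shift i s \<beta>)"
        using s(1) e by (elim disjE) (simp_all add: diff2_def sh)
      thus ?thesis by (simp add: B_quad_def s(3))
    qed
    with V show ?thesis unfolding inserted_def by blast
  qed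
qed

end

theory Submission
  imports Defs
begin

text \<open>
The truncation error splits into three contributions. The term \<open>\<beta> h\<^sup>2 \<Delta>\<^sub>h u\<close> is
\<open>O(h\<^sup>2)\<close> because second difference quotients of \<open>u\<close> are bounded. The Hamiltonian contributes
\<open>O(h\<^sup>2)\<close> because central differences approximate the gradient to second order and all gradients
stay in one ball, on which \<open>H\<close> has a single Lipschitz constant in \<open>q\<close>
(\<open>locally_lipschitz_on_first_uniform\<close>). The order is decided by the numerical moment
\<open>\<gamma> h\<^sup>p (\<Delta>\<^sub>2\<^sub>h - \<Delta>\<^sub>h) u\<close>.

Everything about the moment follows from one identity. If \<open>D\<close> is the second difference in direction
\<open>i\<close>, then the wide second difference is \<open>(D\<^sub>+ + 2 D + D\<^sub>-) / 4\<close>, where \<open>D\<^sub>+\<close> and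
\<open>D\<^sub>-\<close> are the values of \<open>D\<close> at the two neighbours; hence the defect of the two second differences is
\<open>((D\<^sub>+ - D) - (D - D\<^sub>-)) / 4\<close> (\<open>diff2_wide_minus_diff2\<close>). Ghost values enter only through
\<open>D\<close> at a boundary neighbour, and that is exactly the quantity the auxiliary conditions prescribe:

\<^item> in the interior grid, both neighbours are inner nodes and the defect is a fourth difference divided by the
  squared step, \<open>O(h\<^sup>2)\<close> (\<open>lap_defect_interior\<close>);
\<^item> \<open>B_lin\<close> sets \<open>D = 0\<close> at a boundary neighbour, so that the defect is merely bounded
  (\<open>lap_defect_B_lin\<close>);
\<^item> \<open>B_quad\<close> makes \<open>D\<close> at a boundary neighbour equal to \<open>D\<close> at the node, so that the
  difference of \<open>D\<close> towards it vanishes, while a difference of \<open>D\<close> towards an inner neighbour is a third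
  difference divided by the squared step, \<open>O(h)\<close> (\<open>lap_defect_B_quad\<close>).

Multiplying by \<open>h\<^sup>p\<close> gives the three orders; the other two contributions are of no lower order, as
\<open>p + 1 \<le> 2\<close>.

Grid lines may end on the boundary, where only the continuous extensions of the derivatives are available.
All one-dimensional estimates are therefore derived from the mean value theorem, which asks for derivatives
in the open interval and for continuity at its ends.
\<close>

section \<open>Differences of functions with bounded derivatives\<close>

text \<open>The functions \<open>f m\<close> are the successive derivatives of \<open>f 0\<close> in the open interval together
  with their continuous extensions to its endpoints.\<close>

definition deriv_chain :: "nat \<Rightarrow> real \<Rightarrow> real \<Rightarrow> (nat \<Rightarrow> real \<Rightarrow> real) \<Rightarrow> bool" where
  "deriv_chain n l r f \<longleftrightarrow>
     (\<forall>m\<le>n. continuous_on {l..r} (f m)) \<and>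
     (\<forall>m<n. \<forall>t. l < t \<longrightarrow> t < r \<longrightarrow> (f m has_real_derivative f (Suc m) t) (at t))"

lemma deriv_chain_mono:
  assumes "deriv_chain n l r f" "m \<le> n" "l \<le> l'" "r' \<le> r"
  shows "deriv_chain m l' r' f"
proof -
  have "continuous_on {l'..r'} (f k)" if "k \<le> m" for k
    by (rule continuous_on_subset[of "{l..r}"]) (use assms that in \<open>auto simp: deriv_chain_def\<close>)
  thus ?thesis using assms unfolding deriv_chain_def by auto
qed

lemma mvt_open:
  fixes f :: "real \<Rightarrow> real"
  assumes "x < y" "continuous_on {x..y} f"
    "\<And>t. x < t \<Longrightarrow> t < y \<Longrightarrow> (f has_real_derivative f' t) (at t)"
  obtains z where "x < z" "z < y" "f y - f x = (y - x) * f' z"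
proof -
  obtain l z where z: "x < z" "z < y" "DERIV f z :> l" "f y - f x = (y - x) * l"
    using MVT[OF assms(1,2)] assms(3) real_differentiable_def by blast
  thus ?thesis using that assms(3) DERIV_unique by metis
qed

lemma deriv_chain_diff_bound:
  assumes f: "deriv_chain (Suc m) l r f" and M: "\<And>t. l \<le> t \<Longrightarrow> t \<le> r \<Longrightarrow> \<bar>f (Suc m) t\<bar> \<le> M"
    and t: "l \<le> s" "s \<le> t" "t \<le> r"
  shows "\<bar>f m t - f m s\<bar> \<le> (t - s) * M"
proof (cases "s = t")
  case False
  have "deriv_chain (Suc m) s t f" using deriv_chain_mono[OF f order_refl] t by simp
  hence "continuous_on {s..t} (f m)"
    "\<And>z. s < z \<Longrightarrow> z < t \<Longrightarrow> (f m has_real_derivative f (Suc m) z) (at z)"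
    by (auto simp: deriv_chain_def)
  with False t obtain z where "s < z" "z < t" "f m t - f m s = (t - s) * f (Suc m) z"
    using mvt_open[of s t "f m" "f (Suc m)"] by auto
  thus ?thesis using M[of z] t by (simp add: abs_mult mult_left_mono)
qed simp

definition fwd_diff :: "real \<Rightarrow> (real \<Rightarrow> real) \<Rightarrow> real \<Rightarrow> real" where
  "fwd_diff h \<phi> t = \<phi> (t + h) - \<phi> t"

lemma fwd_diff_iterates:
  "(fwd_diff h ^^ 2) \<phi> t = \<phi> (t + 2 * h) - 2 * \<phi> (t + h) + \<phi> t"
  "(fwd_diff h ^^ 3) \<phi> t = \<phi> (t + 3 * h) - 3 * \<phi> (t + 2 * h) + 3 * \<phi> (t + h) - \<phi> t"
  "(fwd_diff h ^^ 4) \<phi> t =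
     \<phi> (t + 4 * h) - 4 * \<phi> (t + 3 * h) + 6 * \<phi> (t + 2 * h) - 4 * \<phi> (t + h) + \<phi> t"
proof -
  have [simp]: "h + h = 2 * h" "h + 2 * h = 3 * h" "h + 3 * h = 4 * h" by simp_all
  show 2: "(fwd_diff h ^^ 2) \<phi> t = \<phi> (t + 2 * h) - 2 * \<phi> (t + h) + \<phi> t" for t
    by (simp add: numeral_2_eq_2 fwd_diff_def add.assoc)
  have "(fwd_diff h ^^ 3) \<phi> t = fwd_diff h ((fwd_diff h ^^ 2) \<phi>) t" for t
    by (simp add: numeral_3_eq_3 numeral_2_eq_2)
  thus 3: "(fwd_diff h ^^ 3) \<phi> t = \<phi> (t + 3 * h) - 3 * \<phi> (t + 2 * h) + 3 * \<phi> (t + h) - \<phi> t" for t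
    by (simp add: fwd_diff_def 2 add.assoc)
  have "(fwd_diff h ^^ 4) \<phi> t = fwd_diff h ((fwd_diff h ^^ 3) \<phi>) t"
    by (simp add: eval_nat_numeral)
  thus "(fwd_diff h ^^ 4) \<phi> t =
     \<phi> (t + 4 * h) - 4 * \<phi> (t + 3 * h) + 6 * \<phi> (t + 2 * h) - 4 * \<phi> (t + h) + \<phi> t"
    by (simp add: fwd_diff_def 3 add.assoc)
qed

text \<open>By induction on the order: \<open>fwd_diff h\<close> commutes with differentiation, and applied to the last
  derivative but one it is at most \<open>h * M\<close> by the mean value theorem. Hence \<open>fwd_diff h (f 0)\<close>
  satisfies the hypotheses with order \<open>n - 1\<close> and bound \<open>h * M\<close>, on an interval that is shorter by
  \<open>h\<close>.\<close>

lemma fwd_diff_bound: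
  assumes "deriv_chain n l r f" "\<And>t. l \<le> t \<Longrightarrow> t \<le> r \<Longrightarrow> \<bar>f n t\<bar> \<le> M"
    and "0 \<le> h" "l \<le> x" "x + real n * h \<le> r"
  shows "\<bar>(fwd_diff h ^^ n) (f 0) x\<bar> \<le> h ^ n * M"
  using assms
proof (induction n arbitrary: f r M)
  case 0
  thus ?case by simp
next
  case (Suc n)
  define \<psi> where "\<psi> m = fwd_diff h (f m)" for m
  have "deriv_chain n l (r - h) \<psi>"
    unfolding deriv_chain_def
  proof (intro conjI allI impI)
    fix m assume "m \<le> n"
    hence "continuous_on {l..r} (f m)" using Suc.prems(1) by (simp add: deriv_chain_def)
    moreover from this have "continuous_on {l..r - h} (\<lambda>t. f m (t + h))"
      by (rule continuous_on_compose2) (use \<open>0 \<le> h\<close> in \<open>auto intro!: continuous_intros\<close>)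
    ultimately have "continuous_on {l..r - h} (f m)" "continuous_on {l..r - h} (\<lambda>t. f m (t + h))"
      using \<open>0 \<le> h\<close> by (auto intro: continuous_on_subset)
    thus "continuous_on {l..r - h} (\<psi> m)"
      by (simp add: \<psi>_def fwd_diff_def[abs_def] continuous_on_diff)
  next
    fix m t assume "m < n" "l < t" "t < r - h"
    hence "(f m has_real_derivative f (Suc m) t) (at t)"
      "(f m has_real_derivative f (Suc m) (t + h)) (at (t + h))"
      using Suc.prems(1) \<open>0 \<le> h\<close> by (auto simp: deriv_chain_def)
    thus "(\<psi> m has_real_derivative \<psi> (Suc m) t) (at t)"
      by (auto simp: \<psi>_def fwd_diff_def[abs_def] DERIV_shift intro: DERIV_diff)
  qed
  moreover have "\<bar>\<psi> n t\<bar> \<le> h * M" if "l \<le> t" "t \<le> r - h" for t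
    using deriv_chain_diff_bound[OF Suc.prems(1,2), of t "t + h"] that \<open>0 \<le> h\<close>
    by (simp add: \<psi>_def fwd_diff_def)
  moreover have "x + real n * h \<le> r - h" using Suc.prems(5) by (simp add: algebra_simps)
  ultimately have "\<bar>(fwd_diff h ^^ n) (\<psi> 0) x\<bar> \<le> h ^ n * (h * M)"
    using Suc.IH Suc.prems(3,4) by blast
  thus ?case by (simp add: \<psi>_def funpow_Suc_right mult_ac del: funpow.simps)
qed

text \<open>One integration step, with the integral replaced by the mean value theorem; the lost factor
  \<open>1 / (k + 1)\<close> only affects constants.\<close>

lemma power_bound_of_deriv:
  fixes f :: "real \<Rightarrow> real"
  assumes "f 0 = 0" "continuous_on {0..h} f" "0 \<le> C"
    "\<And>t. 0 < t \<Longrightarrow> t < h \<Longrightarrow> (f has_real_derivative f' t) (at t)"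
    "\<And>t. 0 < t \<Longrightarrow> t < h \<Longrightarrow> \<bar>f' t\<bar> \<le> C * t ^ k"
    and t: "0 \<le> t" "t \<le> h"
  shows "\<bar>f t\<bar> \<le> C * t ^ Suc k"
proof (cases "t = 0")
  case False
  have "continuous_on {0..t} f" using assms(2) t by (auto intro: continuous_on_subset)
  then obtain z where z: "0 < z" "z < t" "f t - f 0 = (t - 0) * f' z"
    using mvt_open[of 0 t f f'] False assms(4) t by auto
  have "\<bar>f' z\<bar> \<le> C * z ^ k" using assms(5) z t by simp
  also have "\<dots> \<le> C * t ^ k" using z \<open>0 \<le> C\<close> by (intro mult_left_mono power_mono) auto
  finally show ?thesis using z t assms(1) by (simp add: abs_mult mult_ac mult_left_mono)
qed (use assms in simp)

text \<open>The odd part \<open>f(t) - f(-t) - 2 t f'(0)\<close> vanishes at \<open>0\<close> together with its first two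
  derivatives, and its third derivative \<open>f'''(t) + f'''(-t)\<close> is at most \<open>2 M\<close>. Integrating three times
  bounds it by \<open>2 M t\<^sup>3\<close>.\<close>

lemma central_diff_bound:
  assumes f: "deriv_chain 3 (-h) h f" and M: "\<And>t. -h \<le> t \<Longrightarrow> t \<le> h \<Longrightarrow> \<bar>f 3 t\<bar> \<le> M" and h: "0 < h"
  shows "\<bar>(f 0 h - f 0 (-h)) / (2 * h) - f 1 0\<bar> \<le> M * h\<^sup>2"
proof -
  have M0: "0 \<le> M" using M[of 0] h by simp
  have c: "continuous_on {0..h} (f m)" "continuous_on {0..h} (\<lambda>t. f m (-t))" if "m \<le> 3" for m
  proof -
    have *: "continuous_on {-h..h} (f m)" using f that by (simp add: deriv_chain_def)
    from * show "continuous_on {0..h} (f m)" by (rule continuous_on_subset) (use h in auto)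
    from * show "continuous_on {0..h} (\<lambda>t. f m (-t))"
      by (rule continuous_on_compose2) (use h in \<open>auto intro!: continuous_intros\<close>)
  qed
  have d: "(f m has_real_derivative f (Suc m) t) (at t)"
    "((\<lambda>t. f m (-t)) has_real_derivative - f (Suc m) (-t)) (at t)" if "m < 3" "0 < t" "t < h" for m t
  proof -
    have *: "(f m has_real_derivative f (Suc m) s) (at s)" if "-h < s" "s < h" for s
      using f \<open>m < 3\<close> that by (simp add: deriv_chain_def)
    show "(f m has_real_derivative f (Suc m) t) (at t)" using * that by simp
    show "((\<lambda>t. f m (-t)) has_real_derivative - f (Suc m) (-t)) (at t)"
      using *[of "-t"] that by (simp add: DERIV_mirror)
  qed
  have 2: "\<bar>f 2 t - f 2 (-t)\<bar> \<le> 2 * M * t ^ Suc 0" if "0 \<le> t" "t \<le> h" for t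
  proof (rule power_bound_of_deriv[where h = h])
    show "((\<lambda>t. f 2 t - f 2 (-t)) has_real_derivative f 3 s + f 3 (-s)) (at s)"
      if "0 < s" "s < h" for s
      using DERIV_diff[OF d[of 2 s]] that by (simp add: numeral_3_eq_3 numeral_2_eq_2)
    show "\<bar>f 3 s + f 3 (-s)\<bar> \<le> 2 * M * s ^ 0" if "0 < s" "s < h" for s
      using M[of s] M[of "-s"] that by simp
    show "continuous_on {0..h} (\<lambda>t. f 2 t - f 2 (-t))"
      by (intro continuous_on_diff c) simp_all
  qed (use M0 that in simp_all)
  have 1: "\<bar>f 1 t + f 1 (-t) - 2 * f 1 0\<bar> \<le> 2 * M * t ^ Suc (Suc 0)" if "0 \<le> t" "t \<le> h" for t
  proof (rule power_bound_of_deriv[where h = h])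
    show "((\<lambda>t. f 1 t + f 1 (-t) - 2 * f 1 0) has_real_derivative f 2 s - f 2 (-s)) (at s)"
      if "0 < s" "s < h" for s
      using DERIV_diff[OF DERIV_add[OF d[of 1 s]] DERIV_const] that by (simp add: numeral_2_eq_2)
    show "\<bar>f 2 s - f 2 (-s)\<bar> \<le> 2 * M * s ^ Suc 0" if "0 < s" "s < h" for s
      using 2 that by simp
    show "continuous_on {0..h} (\<lambda>t. f 1 t + f 1 (-t) - 2 * f 1 0)"
      by (intro continuous_on_diff continuous_on_add continuous_on_const c) simp_all
  qed (use M0 that in simp_all)
  have 0: "\<bar>f 0 t - f 0 (-t) - t * (2 * f 1 0)\<bar> \<le> 2 * M * t ^ Suc (Suc (Suc 0))"
    if "0 \<le> t" "t \<le> h" for t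
  proof (rule power_bound_of_deriv[where h = h])
    show "((\<lambda>t. f 0 t - f 0 (-t) - t * (2 * f 1 0)) has_real_derivative f 1 s + f 1 (-s) - 2 * f 1 0) (at s)"
      if "0 < s" "s < h" for s
      using DERIV_diff[OF DERIV_diff[OF d[of 0 s]] DERIV_cmult_right[OF DERIV_ident]] that by simp
    show "\<bar>f 1 s + f 1 (-s) - 2 * f 1 0\<bar> \<le> 2 * M * s ^ Suc (Suc 0)" if "0 < s" "s < h" for s
      using 1 that by simp
    show "continuous_on {0..h} (\<lambda>t. f 0 t - f 0 (-t) - t * (2 * f 1 0))"
      by (intro continuous_on_diff continuous_on_mult continuous_on_const continuous_on_id c) simp_all
  qed (use M0 that in simp_all)
  have "(f 0 h - f 0 (-h)) / (2 * h) - f 1 0 = (f 0 h - f 0 (-h) - h * (2 * f 1 0)) / (2 * h)"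
    using h by (simp add: field_simps)
  also have "\<bar>\<dots>\<bar> = \<bar>f 0 h - f 0 (-h) - h * (2 * f 1 0)\<bar> / (2 * h)"
    using h by (simp add: abs_divide)
  also have "\<dots> \<le> 2 * M * h ^ 3 / (2 * h)"
    using 0[of h] h unfolding numeral_3_eq_3 by (intro divide_right_mono) simp_all
  also have "\<dots> = M * h\<^sup>2" using h by (simp add: power2_eq_square power3_eq_cube)
  finally show ?thesis .
qed

section \<open>Partial derivatives and uniform Lipschitz constants\<close>

text \<open>Each difference operator acts along a single coordinate direction, so the iterated partial
  derivatives are followed in one fixed direction \<open>i\<close>.\<close>

lemma C_closure_derivs:
  fixes f :: "real ^ 'n::finite \<Rightarrow> real"
  assumes "C_closure k S f"
  shows "\<exists>d. d 0 = f \<and> (\<forall>m\<le>k. continuous_on (closure S) (d m)) \<and>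
    (\<forall>m<k. \<forall>x\<in>S. ((\<lambda>t. d m (x + t *\<^sub>R axis i 1)) has_real_derivative d (Suc m) x) (at 0))"
  using assms
proof (induction k arbitrary: f)
  case 0
  thus ?case by (intro exI[of _ "\<lambda>_. f"]) auto
next
  case (Suc k)
  have f: "continuous_on (closure S) f"
    and "\<exists>g. \<forall>j. C_closure k S (g j) \<and>
      (\<forall>x\<in>S. ((\<lambda>t. f (x + t *\<^sub>R axis j 1)) has_real_derivative g j x) (at 0))"
    using Suc.prems by simp_all
  then obtain g where g: "\<forall>j. C_closure k S (g j) \<and>
      (\<forall>x\<in>S. ((\<lambda>t. f (x + t *\<^sub>R axis j 1)) has_real_derivative g j x) (at 0))"
    by (elim exE)
  note g = g[THEN spec, THEN conjunct1, of i] g[THEN spec, THEN conjunct2, of i]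
  obtain d where d: "d 0 = g i" "\<forall>m\<le>k. continuous_on (closure S) (d m)"
    "\<forall>m<k. \<forall>x\<in>S. ((\<lambda>t. d m (x + t *\<^sub>R axis i 1)) has_real_derivative d (Suc m) x) (at 0)"
    using Suc.IH[OF g(1)] by blast
  have "continuous_on (closure S) (case_nat f d m)" if "m \<le> Suc k" for m
    using that f d(2) by (cases m) auto
  moreover have "((\<lambda>t. case_nat f d m (x + t *\<^sub>R axis i 1)) has_real_derivative
      case_nat f d (Suc m) x) (at 0)" if "m < Suc k" "x \<in> S" for m x
    using that g(2) d(1,3) by (cases m) auto
  ultimately show ?case by (intro exI[of _ "case_nat f d"] conjI allI impI ballI) simp_all
qed

text \<open>With the second component viewed as a parameter that ranges over a compact set, local Lipschitz
  continuity turns into a common Lipschitz constant for the first component on a compact set.\<close>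

lemma locally_lipschitz_on_first_uniform:
  fixes f :: "'a::heine_borel \<times> 'b::metric_space \<Rightarrow> 'c::metric_space"
  assumes f: "locally_lipschitz_on (UNIV \<times> S) f" and "compact K" "compact T" "T \<subseteq> S"
  obtains L where "0 \<le> L" "\<And>t x y. t \<in> T \<Longrightarrow> x \<in> K \<Longrightarrow> y \<in> K \<Longrightarrow> dist (f (x, t)) (f (y, t)) \<le> L * dist x y"
proof -
  have near: "\<exists>r>0. \<exists>L. L-lipschitz_on (ball (x, t) r \<inter> UNIV \<times> S) f" if "t \<in> T" for x t
    using f that \<open>T \<subseteq> S\<close> unfolding locally_lipschitz_on_def by blast
  have ll: "local_lipschitz T K (\<lambda>t x. f (x, t))"
  proof (rule local_lipschitzI)
    fix t x assume "t \<in> T" "x \<in> K"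
    then obtain r L where r: "0 < r" "L-lipschitz_on (ball (x, t) r \<inter> UNIV \<times> S) f"
      using near by blast
    have lip: "L-lipschitz_on (cball x (r / 3) \<inter> K) (\<lambda>x. f (x, s))" if s: "s \<in> cball t (r / 3) \<inter> T" for s
    proof (rule lipschitz_onI)
      have *: "(y, s) \<in> ball (x, t) r \<inter> UNIV \<times> S" if "y \<in> cball x (r / 3)" for y
      proof -
        have "dist (x, t) (y, s) \<le> dist x y + dist t s"
          by (simp add: dist_Pair_Pair sqrt_sum_squares_le_sum)
        also have "\<dots> < r" using that s r(1) by simp
        finally show ?thesis using s \<open>T \<subseteq> S\<close> by auto
      qed
      fix y z assume "y \<in> cball x (r / 3) \<inter> K" "z \<in> cball x (r / 3) \<inter> K"
      hence "dist (f (y, s)) (f (z, s)) \<le> L * dist (y, s) (z, s)"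
        using * by (intro lipschitz_onD[OF r(2)]) auto
      thus "dist (f (y, s)) (f (z, s)) \<le> L * dist y z" by (simp add: dist_Pair_Pair)
    qed (rule lipschitz_on_nonneg[OF r(2)])
    show "\<exists>u>0. \<exists>L. \<forall>s\<in>cball t u \<inter> T. L-lipschitz_on (cball x u \<inter> K) (\<lambda>x. f (x, s))"
      by (rule exI[of _ "r / 3"], intro conjI exI[of _ L] ballI) (use r(1) lip in simp_all)
  qed
  have "continuous_on T (\<lambda>t. f (x, t))" for x
    unfolding continuous_on_eq_continuous_within
  proof
    fix t assume "t \<in> T"
    then obtain r L where r: "0 < r" "L-lipschitz_on (ball (x, t) r \<inter> UNIV \<times> S) f"
      using near by blast
    have "continuous_on (ball (x, t) r \<inter> UNIV \<times> S) f" using r(2) by (rule lipschitz_on_continuous_on)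
    hence "continuous_on (ball t r \<inter> T) (\<lambda>t. f (x, t))"
      by (rule continuous_on_compose2)
        (use \<open>T \<subseteq> S\<close> in \<open>auto intro!: continuous_intros simp: dist_Pair_Pair\<close>)
    hence "continuous (at t within (ball t r \<inter> T)) (\<lambda>t. f (x, t))"
      using \<open>t \<in> T\<close> r(1) by (simp add: continuous_on_eq_continuous_within)
    moreover have "at t within (ball t r \<inter> T) = at t within T"
      using r(1) by (intro at_within_nhd[of t "ball t r"]) auto
    ultimately show "continuous (at t within T) (\<lambda>t. f (x, t))" by simp
  qed
  then obtain L where L: "\<And>t. t \<in> T \<Longrightarrow> L-lipschitz_on K (\<lambda>x. f (x, t))"
    using local_lipschitz_compact_implies_lipschitz[OF ll assms(2,3)] by blast
  have "dist (f (x, t)) (f (y, t)) \<le> max L 0 * dist x y" if "t \<in> T" "x \<in> K" "y \<in> K" for t x y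
    using lipschitz_onD[OF L[OF that(1)] that(2,3)] lipschitz_on_nonneg[OF L[OF that(1)]] by simp
  thus ?thesis using that[of "max L 0"] by simp
qed

section \<open>Grid geometry\<close>

lemma step_pos:
  assumes "a $ i < b $ i" "2 \<le> J i"
  shows "0 < step a b J i"
  using assms by (simp add: step_def)

lemma step_le_mesh: "step a b J i \<le> mesh a b J"
  by (simp add: mesh_def)

lemma shift_shift [simp]: "shift i k (shift i l \<alpha>) = shift i (k + l) \<alpha>" "shift i 0 \<alpha> = \<alpha>"
  by (simp_all add: shift_def fun_eq_iff)

lemma node_shift: "node a b J (shift i k \<alpha>) = node a b J \<alpha> + (of_int k * step a b J i) *\<^sub>R axis i 1"
  by (simp add: node_def shift_def vec_eq_iff axis_def distrib_right left_diff_distrib)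

lemma inner_nodes_iff:
  assumes "\<And>i. a $ i < b $ i" "\<And>i. 2 \<le> J i"
  shows "\<alpha> \<in> inner_nodes a b J \<longleftrightarrow> (\<forall>i. 1 < \<alpha> i \<and> \<alpha> i < int (J i))"
  using node_in_box[where a = a and b = b and J = J, OF assms]
  by (auto simp: inner_nodes_def grid_idx_def less_imp_le)

lemma shift_inner_in_grid:
  assumes "\<And>i. a $ i < b $ i" "\<And>i. 2 \<le> J i" and "\<alpha> \<in> inner_nodes a b J" "\<bar>k\<bar> \<le> 1"
  shows "shift i k \<alpha> \<in> grid_idx J"
proof -
  have *: "1 < \<alpha> j \<and> \<alpha> j < int (J j)" for j
    using assms(3) inner_nodes_iff[where a = a and b = b and J = J, OF assms(1,2)] by blast
  have "1 \<le> shift i k \<alpha> j \<and> shift i k \<alpha> j \<le> int (J j)" for j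
    using *[of j] assms(4) by (auto simp: shift_def)
  thus ?thesis by (simp add: grid_idx_def)
qed

lemma node_in_closed_box:
  assumes "\<And>i. a $ i < b $ i" "\<And>i. 2 \<le> J i" and "\<alpha> \<in> grid_idx J"
  shows "node a b J \<alpha> \<in> cbox a b"
proof -
  have "a $ i \<le> node a b J \<alpha> $ i \<and> node a b J \<alpha> $ i \<le> b $ i" for i
  proof -
    have s: "0 < step a b J i" using assms(1,2) by (rule step_pos)
    have "1 \<le> \<alpha> i" "\<alpha> i \<le> int (J i)" using assms(3) by (auto simp: grid_idx_def)
    hence "0 \<le> real_of_int (\<alpha> i) - 1" "real_of_int (\<alpha> i) - 1 \<le> real (J i) - 1" by linarith+
    hence "0 \<le> (real_of_int (\<alpha> i) - 1) * step a b J i"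
      "(real_of_int (\<alpha> i) - 1) * step a b J i \<le> (real (J i) - 1) * step a b J i"
      using s by (simp_all add: mult_right_mono)
    moreover have "(real (J i) - 1) * step a b J i = b $ i - a $ i"
      using assms(2)[of i] by (simp add: step_def)
    ultimately show ?thesis by (simp add: node_def)
  qed
  thus ?thesis by (simp add: mem_box_cart)
qed

lemma box_nonempty_cart:
  fixes a b :: "real ^ 'n"
  assumes "\<And>i. a $ i < b $ i"
  shows "box a b \<noteq> {}"
  using assms by (simp add: interval_ne_empty_cart)

lemma interior_grid_neighbour:
  assumes ab: "\<And>i. a $ i < b $ i" "\<And>i. 2 \<le> J i" and "\<alpha> \<in> interior_grid a b J" "s = 1 \<or> s = -1"
  shows "shift i s \<alpha> \<in> inner_nodes a b J"
proof -
  have \<alpha>: "\<alpha> \<in> inner_nodes a b J" "node a b J (shift i s \<alpha>) \<notin> frontier (box a b)"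
    using assms(3,4) by (auto simp: interior_grid_def)
  have g: "shift i s \<alpha> \<in> grid_idx J" using shift_inner_in_grid[where a = a and b = b, OF ab \<alpha>(1)] assms(4) by auto
  have "node a b J (shift i s \<alpha>) \<in> cbox a b" by (rule node_in_closed_box[OF ab g])
  thus ?thesis using \<alpha>(2) g box_nonempty_cart[OF ab(1)] by (simp add: frontier_box inner_nodes_def)
qed

text \<open>A neighbour of an inner node is either inner, or a boundary node at which the auxiliary condition
  for the same direction holds. Every case distinction near the boundary rests on this.\<close>

lemma outer_neighbour_in_bdry_nodes:
  assumes ab: "\<And>i. a $ i < b $ i" "\<And>i. 2 \<le> J i" and \<alpha>: "\<alpha> \<in> inner_nodes a b J" and s: "s = 1 \<or> s = -1"
    and out: "shift i s \<alpha> \<notin> inner_nodes a b J"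
  shows "shift i s \<alpha> \<in> bdry_nodes a b J i" "inner_nbr a b J i (shift i s \<alpha>) = \<alpha>"
proof -
  have g: "shift i s \<alpha> \<in> grid_idx J" using shift_inner_in_grid[where a = a and b = b, OF ab \<alpha>] s by auto
  have "node a b J (shift i s \<alpha>) \<in> cbox a b" by (rule node_in_closed_box[OF ab g])
  hence "node a b J (shift i s \<alpha>) \<in> frontier (box a b)"
    using out g box_nonempty_cart[OF ab(1)] by (simp add: frontier_box inner_nodes_def)
  thus b: "shift i s \<alpha> \<in> bdry_nodes a b J i" using g \<alpha> s by (auto simp: bdry_nodes_def)
  obtain s' where s': "s' = 1 \<or> s' = -1" "inner_nbr a b J i (shift i s \<alpha>) = shift i s' (shift i s \<alpha>)"
    "(s' = 1 \<and> shift i s \<alpha> i = 1) \<or> (s' = -1 \<and> shift i s \<alpha> i = int (J i))"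
    using bdry_nodeD[where a = a and b = b and J = J, OF ab b] by metis
  have "1 < \<alpha> i" "\<alpha> i < int (J i)"
    using \<alpha> inner_nodes_iff[where a = a and b = b and J = J, OF ab] by blast+
  hence "s' = - s" using s s'(1,3) by (auto simp: shift_def)
  thus "inner_nbr a b J i (shift i s \<alpha>) = \<alpha>" using s'(2) by simp
qed

text \<open>The wide second difference is the average of second differences with weights
  \<open>1/4, 1/2, 1/4\<close>: in the combination \<open>D\<^sub>+ + 2 D + D\<^sub>-\<close> the values of \<open>V\<close> at the two
  direct neighbours cancel.\<close>

lemma diff2_wide_minus_diff2:
  "diff2_wide h i V \<alpha> - diff2 h i V \<alpha> =
     (diff2 h i V (shift i 1 \<alpha>) - 2 * diff2 h i V \<alpha> + diff2 h i V (shift i (-1) \<alpha>)) / 4"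
proof -
  have "(A - 2 * B + C) / (4 * h\<^sup>2) - (P - 2 * B + Q) / h\<^sup>2 =
      ((A - 2 * P + B) / h\<^sup>2 - 2 * ((P - 2 * B + Q) / h\<^sup>2) + (B - 2 * Q + C) / h\<^sup>2) / 4"
    for A B C P Q :: real
    by (simp add: add_divide_distrib diff_divide_distrib)
  thus ?thesis by (simp add: diff2_wide_def diff2_def)
qed

lemma lap_wide_minus_lap_le:
  fixes hs :: "'n::finite \<Rightarrow> real"
  assumes "\<And>i. \<bar>diff2 (hs i) i V (shift i 1 \<alpha>) - 2 * diff2 (hs i) i V \<alpha> + diff2 (hs i) i V (shift i (-1) \<alpha>)\<bar> \<le> 4 * c"
  shows "\<bar>lap_wide hs V \<alpha> - lap hs V \<alpha>\<bar> \<le> real CARD('n) * c"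
proof -
  have "\<bar>lap_wide hs V \<alpha> - lap hs V \<alpha>\<bar> \<le> (\<Sum>i\<in>UNIV. \<bar>diff2_wide (hs i) i V \<alpha> - diff2 (hs i) i V \<alpha>\<bar>)"
    unfolding lap_wide_def lap_def sum_subtractf[symmetric] by (rule sum_abs)
  also have "\<dots> \<le> (\<Sum>i\<in>(UNIV :: 'n set). c)"
    using assms by (intro sum_mono) (simp add: diff2_wide_minus_diff2 abs_divide mult.commute)
  finally show ?thesis by simp
qed

section \<open>Grid values of a smooth function\<close>

text \<open>A grid function that carries the values of \<open>u\<close> on the grid, with arbitrary ghost values. Here
  \<open>d i m\<close> is the continuous extension of the \<open>m\<close>-th partial derivative in direction \<open>i\<close>.
  Order four is what the fourth difference in the interior requires.\<close>

locale sampled_function =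
  fixes a b :: "real ^ 'n::finite" and J :: "'n \<Rightarrow> nat"
    and u :: "real ^ 'n \<Rightarrow> real" and V :: "'n gridfun"
    and d :: "'n \<Rightarrow> nat \<Rightarrow> real ^ 'n \<Rightarrow> real" and M :: real
  assumes ab: "\<And>i. a $ i < b $ i" and J: "\<And>i. 2 \<le> J i"
    and samples: "\<And>\<alpha>. \<alpha> \<in> grid_idx J \<Longrightarrow> V \<alpha> = u (node a b J \<alpha>)"
    and d_0: "\<And>i. d i 0 = u"
    and d_cont: "\<And>i m. m \<le> 4 \<Longrightarrow> continuous_on (cbox a b) (d i m)"
    and d_deriv: "\<And>i m x. m < 4 \<Longrightarrow> x \<in> box a b \<Longrightarrow>
      ((\<lambda>t. d i m (x + t *\<^sub>R axis i 1)) has_real_derivative d i (Suc m) x) (at 0)"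
    and d_bound: "\<And>i m x. m \<le> 4 \<Longrightarrow> x \<in> cbox a b \<Longrightarrow> \<bar>d i m x\<bar> \<le> M"
begin

abbreviation D :: "'n \<Rightarrow> 'n gridfun" where
  "D i \<equiv> diff2 (step a b J i) i V"

lemma M_nonneg: "0 \<le> M"
proof -
  obtain x where "x \<in> cbox a b" using box_nonempty_cart[OF ab] box_subset_cbox by blast
  thus ?thesis using d_bound[of 0 x] abs_ge_zero order_trans by blast
qed

text \<open>A line in a coordinate direction through a point of the open box stays in the open box until it
  reaches the boundary, so only the ends of the segment can be boundary points.\<close>

lemma line_deriv_chain:
  assumes x: "x \<in> box a b" and l: "x + l *\<^sub>R axis i 1 \<in> cbox a b" and r: "x + r *\<^sub>R axis i 1 \<in> cbox a b"
  shows "deriv_chain 4 l r (\<lambda>m t. d i m (x + t *\<^sub>R axis i 1))"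
    and "\<And>m t. m \<le> 4 \<Longrightarrow> l \<le> t \<Longrightarrow> t \<le> r \<Longrightarrow> \<bar>d i m (x + t *\<^sub>R axis i 1)\<bar> \<le> M"
proof -
  have comp: "(x + t *\<^sub>R axis i 1) $ j = (if j = i then x $ i + t else x $ j)" for t j
    by (simp add: axis_def)
  have X: "a $ j < x $ j \<and> x $ j < b $ j" for j using x by (simp add: mem_box_cart)
  have li: "a $ i \<le> x $ i + l" and ri: "x $ i + r \<le> b $ i"
    using l r by (auto simp: mem_box_cart axis_def dest: spec[of _ i])
  have closed: "x + t *\<^sub>R axis i 1 \<in> cbox a b" if "l \<le> t" "t \<le> r" for t
    using X li ri that unfolding mem_box_cart comp by (auto simp: less_imp_le)
  have opened: "x + t *\<^sub>R axis i 1 \<in> box a b" if "l < t" "t < r" for t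
    using X li ri that unfolding mem_box_cart comp by auto
  show "\<bar>d i m (x + t *\<^sub>R axis i 1)\<bar> \<le> M" if "m \<le> 4" "l \<le> t" "t \<le> r" for m t
    using d_bound closed that by blast
  show "deriv_chain 4 l r (\<lambda>m t. d i m (x + t *\<^sub>R axis i 1))"
    unfolding deriv_chain_def
  proof (intro conjI allI impI)
    fix m :: nat assume "m \<le> 4"
    thus "continuous_on {l..r} (\<lambda>t. d i m (x + t *\<^sub>R axis i 1))"
      by (rule continuous_on_compose2[OF d_cont]) (use closed in \<open>auto intro!: continuous_intros\<close>)
  next
    fix m :: nat and t assume "m < 4" "l < t" "t < r"
    hence "((\<lambda>s. d i m ((x + t *\<^sub>R axis i 1) + s *\<^sub>R axis i 1)) has_real_derivative
        d i (Suc m) (x + t *\<^sub>R axis i 1)) (at 0)"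
      using d_deriv opened by blast
    thus "((\<lambda>t. d i m (x + t *\<^sub>R axis i 1)) has_real_derivative
        d i (Suc m) (x + t *\<^sub>R axis i 1)) (at t)"
      using DERIV_shift[of "\<lambda>t. d i m (x + t *\<^sub>R axis i 1)" _ 0 t]
      by (simp add: algebra_simps)
  qed
qed

lemma grid_difference_le:
  assumes \<alpha>: "\<alpha> \<in> inner_nodes a b J" and n: "n \<le> 4"
    and g: "shift i k \<alpha> \<in> grid_idx J" "shift i (k + int n) \<alpha> \<in> grid_idx J"
  shows "\<bar>(fwd_diff (step a b J i) ^^ n) (\<lambda>t. u (node a b J \<alpha> + t *\<^sub>R axis i 1)) (of_int k * step a b J i)\<bar>
    \<le> step a b J i ^ n * M"
proof -
  let ?x = "node a b J \<alpha>" and ?h = "step a b J i"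
  have x: "?x \<in> box a b" using \<alpha> by (simp add: inner_nodes_def)
  have "?x + (of_int k * ?h) *\<^sub>R axis i 1 \<in> cbox a b"
    "?x + (of_int (k + int n) * ?h) *\<^sub>R axis i 1 \<in> cbox a b"
    using node_in_closed_box[where a = a and b = b, OF ab J g(1)] node_in_closed_box[where a = a and b = b, OF ab J g(2)]
    unfolding node_shift by simp_all
  note line = line_deriv_chain[OF x this]
  show ?thesis
    using fwd_diff_bound[OF deriv_chain_mono[OF line(1) n order_refl order_refl] line(2)[OF n],
        where h = ?h and x = "of_int k * ?h"] step_pos[where a = a and b = b and J = J, OF ab J]
    by (simp add: d_0 algebra_simps less_imp_le)
qed

lemma grid_value_on_line:
  assumes "shift i k \<alpha> \<in> grid_idx J"
  shows "u (node a b J \<alpha> + (of_int k * step a b J i) *\<^sub>R axis i 1) = V (shift i k \<alpha>)"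
  using samples[OF assms] by (simp add: node_shift)

lemma step_sq_D: "(step a b J i)\<^sup>2 * D i \<alpha> = V (shift i 1 \<alpha>) - 2 * V \<alpha> + V (shift i (-1) \<alpha>)"
  using step_pos[where a = a and b = b and J = J and i = i, OF ab J] by (simp add: diff2_def)

text \<open>Forward differences of \<open>u\<close> of order two, three and four along a grid line, divided by the
  squared step, are \<open>D\<close>, its first difference and its second difference. The starting point on the line
  is chosen such that only grid nodes occur.\<close>

lemma D_bound:
  assumes \<alpha>: "\<alpha> \<in> inner_nodes a b J"
  shows "\<bar>D i \<alpha>\<bar> \<le> M"
proof -
  let ?h = "step a b J i"
  have h: "0 < ?h" using ab J by (rule step_pos)
  have g: "shift i k \<alpha> \<in> grid_idx J" if "\<bar>k\<bar> \<le> 1" for k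
    using shift_inner_in_grid[where a = a and b = b, OF ab J \<alpha> that] .
  have "(fwd_diff ?h ^^ 2) (\<lambda>t. u (node a b J \<alpha> + t *\<^sub>R axis i 1)) (of_int (-1) * ?h) = ?h\<^sup>2 * D i \<alpha>"
    using grid_value_on_line[OF g[of "-1"]] grid_value_on_line[OF g[of 0]]
      grid_value_on_line[OF g[of 1]] h
    unfolding step_sq_D by (simp add: fwd_diff_iterates)
  hence "?h\<^sup>2 * \<bar>D i \<alpha>\<bar> \<le> ?h\<^sup>2 * M"
    using grid_difference_le[OF \<alpha>, of 2 i "-1"] g[of "-1"] g[of 1] by (simp add: abs_mult)
  thus ?thesis using h by simp
qed

lemma D_diff_bound:
  assumes \<alpha>: "\<alpha> \<in> inner_nodes a b J" and \<alpha>': "shift i 1 \<alpha> \<in> inner_nodes a b J"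
  shows "\<bar>D i (shift i 1 \<alpha>) - D i \<alpha>\<bar> \<le> M * step a b J i"
proof -
  let ?h = "step a b J i"
  have h: "0 < ?h" using ab J by (rule step_pos)
  note grid = shift_inner_in_grid[where a = a and b = b, OF ab J]
  have g: "shift i (-1) \<alpha> \<in> grid_idx J" "shift i 0 \<alpha> \<in> grid_idx J" "shift i 1 \<alpha> \<in> grid_idx J"
    "shift i 2 \<alpha> \<in> grid_idx J"
    using grid[OF \<alpha>, of "-1" i] grid[OF \<alpha>, of 0 i] grid[OF \<alpha>, of 1 i] grid[OF \<alpha>', of 1 i]
    by simp_all
  have "(fwd_diff ?h ^^ 3) (\<lambda>t. u (node a b J \<alpha> + t *\<^sub>R axis i 1)) (of_int (-1) * ?h) =
      ?h\<^sup>2 * (D i (shift i 1 \<alpha>) - D i \<alpha>)"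
    using g[THEN grid_value_on_line] unfolding right_diff_distrib step_sq_D
    by (simp add: fwd_diff_iterates)
  hence "?h\<^sup>2 * \<bar>D i (shift i 1 \<alpha>) - D i \<alpha>\<bar> \<le> ?h\<^sup>2 * (M * ?h)"
    using grid_difference_le[OF \<alpha>, of 3 i "-1"] g by (simp add: abs_mult power3_eq_cube power2_eq_square mult_ac)
  thus ?thesis using h by simp
qed

lemma D_second_diff_bound:
  assumes \<alpha>: "\<alpha> \<in> inner_nodes a b J" and \<alpha>': "shift i 1 \<alpha> \<in> inner_nodes a b J"
    "shift i (-1) \<alpha> \<in> inner_nodes a b J"
  shows "\<bar>D i (shift i 1 \<alpha>) - 2 * D i \<alpha> + D i (shift i (-1) \<alpha>)\<bar> \<le> M * (step a b J i)\<^sup>2"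
proof -
  let ?h = "step a b J i"
  have h: "0 < ?h" using ab J by (rule step_pos)
  note grid = shift_inner_in_grid[where a = a and b = b, OF ab J]
  have g: "shift i (-2) \<alpha> \<in> grid_idx J" "shift i (-1) \<alpha> \<in> grid_idx J" "shift i 0 \<alpha> \<in> grid_idx J"
    "shift i 1 \<alpha> \<in> grid_idx J" "shift i 2 \<alpha> \<in> grid_idx J"
    using grid[OF \<alpha>, of "-1" i] grid[OF \<alpha>, of 0 i] grid[OF \<alpha>, of 1 i]
      grid[OF \<alpha>'(1), of 1 i] grid[OF \<alpha>'(2), of "-1" i]
    by simp_all
  have "(fwd_diff ?h ^^ 4) (\<lambda>t. u (node a b J \<alpha> + t *\<^sub>R axis i 1)) (of_int (-2) * ?h) =
      ?h\<^sup>2 * (D i (shift i 1 \<alpha>) - 2 * D i \<alpha> + D i (shift i (-1) \<alpha>))"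
    using g[THEN grid_value_on_line]
    unfolding right_diff_distrib distrib_left mult.left_commute[of "?h\<^sup>2" 2] step_sq_D
    by (simp add: fwd_diff_iterates)
  hence "?h\<^sup>2 * \<bar>D i (shift i 1 \<alpha>) - 2 * D i \<alpha> + D i (shift i (-1) \<alpha>)\<bar> \<le> ?h\<^sup>2 * (M * ?h\<^sup>2)"
    using grid_difference_le[OF \<alpha>, of 4 i "-2"] g by (simp add: abs_mult power4_eq_xxxx power2_eq_square mult_ac)
  thus ?thesis using h by simp
qed

lemma grad_eq:
  assumes "x \<in> box a b"
  shows "grad u x $ i = d i 1 x"
  using DERIV_imp_deriv[OF d_deriv[OF _ assms, of 0 i]] by (simp add: grad_def d_0)

lemma diff1_bound:
  assumes \<alpha>: "\<alpha> \<in> inner_nodes a b J"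
  shows "\<bar>diff1 (step a b J i) i V \<alpha> - grad u (node a b J \<alpha>) $ i\<bar> \<le> M * (step a b J i)\<^sup>2"
proof -
  let ?h = "step a b J i" and ?x = "node a b J \<alpha>"
  have h: "0 < ?h" using ab J by (rule step_pos)
  have x: "?x \<in> box a b" using \<alpha> by (simp add: inner_nodes_def)
  have g: "shift i 1 \<alpha> \<in> grid_idx J" "shift i (-1) \<alpha> \<in> grid_idx J"
    using shift_inner_in_grid[where a = a and b = b, OF ab J \<alpha>] by simp_all
  have "?x + (-?h) *\<^sub>R axis i 1 \<in> cbox a b" "?x + ?h *\<^sub>R axis i 1 \<in> cbox a b"
    using g[THEN node_in_closed_box[where a = a and b = b, OF ab J]] unfolding node_shift by simp_all
  note line = line_deriv_chain[OF x this]
  have "\<bar>(d i 0 (?x + ?h *\<^sub>R axis i 1) - d i 0 (?x + (-?h) *\<^sub>R axis i 1)) / (2 * ?h)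
      - d i 1 (?x + 0 *\<^sub>R axis i 1)\<bar> \<le> M * ?h\<^sup>2"
    by (rule central_diff_bound[OF deriv_chain_mono[OF line(1)]]) (use line(2) h in simp_all)
  thus ?thesis using g[THEN grid_value_on_line] by (simp add: grad_eq[OF x] d_0 diff1_def)
qed

lemma norm_grad_h_error:
  assumes \<alpha>: "\<alpha> \<in> inner_nodes a b J"
  shows "norm (grad_h (step a b J) V \<alpha> - grad u (node a b J \<alpha>)) \<le> real CARD('n) * M * (mesh a b J)\<^sup>2"
proof -
  have "norm (grad_h (step a b J) V \<alpha> - grad u (node a b J \<alpha>)) \<le>
      (\<Sum>i\<in>UNIV. \<bar>(grad_h (step a b J) V \<alpha> - grad u (node a b J \<alpha>)) $ i\<bar>)"
    by (rule norm_le_l1_cart)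
  also have "\<dots> \<le> (\<Sum>i\<in>(UNIV :: 'n set). M * (mesh a b J)\<^sup>2)"
  proof (rule sum_mono)
    fix i :: 'n
    have "0 < step a b J i" using ab J by (rule step_pos)
    hence "M * (step a b J i)\<^sup>2 \<le> M * (mesh a b J)\<^sup>2"
      using M_nonneg step_le_mesh[of a b J i] by (intro mult_left_mono power_mono) auto
    thus "\<bar>(grad_h (step a b J) V \<alpha> - grad u (node a b J \<alpha>)) $ i\<bar> \<le> M * (mesh a b J)\<^sup>2"
      using diff1_bound[OF \<alpha>, of i] by (simp add: grad_h_def)
  qed
  finally show ?thesis by simp
qed

lemma norm_grad_le:
  assumes \<alpha>: "\<alpha> \<in> inner_nodes a b J"
  shows "norm (grad u (node a b J \<alpha>)) \<le> real CARD('n) * M"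
proof -
  have x: "node a b J \<alpha> \<in> box a b" using \<alpha> by (simp add: inner_nodes_def)
  have "norm (grad u (node a b J \<alpha>)) \<le> (\<Sum>i\<in>UNIV. \<bar>grad u (node a b J \<alpha>) $ i\<bar>)"
    by (rule norm_le_l1_cart)
  also have "\<dots> \<le> (\<Sum>i\<in>(UNIV :: 'n set). M)"
    using x box_subset_cbox[of a b] by (intro sum_mono) (simp add: grad_eq[OF x] d_bound subset_iff)
  finally show ?thesis by simp
qed

lemma lap_bound:
  assumes \<alpha>: "\<alpha> \<in> inner_nodes a b J"
  shows "\<bar>lap (step a b J) V \<alpha>\<bar> \<le> real CARD('n) * M"
proof -
  have "\<bar>lap (step a b J) V \<alpha>\<bar> \<le> (\<Sum>i\<in>UNIV. \<bar>D i \<alpha>\<bar>)"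
    unfolding lap_def by (rule sum_abs)
  also have "\<dots> \<le> (\<Sum>i\<in>(UNIV :: 'n set). M)" by (intro sum_mono D_bound[OF \<alpha>])
  finally show ?thesis by simp
qed

lemma lap_defect_interior:
  assumes \<alpha>: "\<alpha> \<in> interior_grid a b J"
  shows "\<bar>lap_wide (step a b J) V \<alpha> - lap (step a b J) V \<alpha>\<bar> \<le> real CARD('n) * (M * (mesh a b J)\<^sup>2)"
proof (rule lap_wide_minus_lap_le)
  fix i
  have inner: "\<alpha> \<in> inner_nodes a b J" "shift i 1 \<alpha> \<in> inner_nodes a b J" "shift i (-1) \<alpha> \<in> inner_nodes a b J"
    using \<alpha> interior_grid_neighbour[where a = a and b = b and J = J, OF ab J \<alpha>] by (simp_all add: interior_grid_def)
  have "0 < step a b J i" using ab J by (rule step_pos)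
  hence "M * (step a b J i)\<^sup>2 \<le> M * (mesh a b J)\<^sup>2" "0 \<le> M * (mesh a b J)\<^sup>2"
    using M_nonneg step_le_mesh[of a b J i] by (auto intro!: mult_left_mono power_mono)
  thus "\<bar>D i (shift i 1 \<alpha>) - 2 * D i \<alpha> + D i (shift i (-1) \<alpha>)\<bar> \<le> 4 * (M * (mesh a b J)\<^sup>2)"
    using D_second_diff_bound[OF inner] by linarith
qed

text \<open>Either side contributes a bounded value: a second difference quotient of \<open>u\<close> at an inner
  neighbour, and \<open>0\<close> at a boundary neighbour.\<close>

lemma lap_defect_B_lin:
  assumes \<alpha>: "\<alpha> \<in> inner_nodes a b J"
    and B: "\<And>i \<beta>. \<beta> \<in> bdry_nodes a b J i \<Longrightarrow> B_lin a b J i V \<beta> = 0"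
  shows "\<bar>lap_wide (step a b J) V \<alpha> - lap (step a b J) V \<alpha>\<bar> \<le> real CARD('n) * M"
proof (rule lap_wide_minus_lap_le)
  fix i
  have "\<bar>D i (shift i s \<alpha>)\<bar> \<le> M" if s: "s = 1 \<or> s = -1" for s
  proof (cases "shift i s \<alpha> \<in> inner_nodes a b J")
    case False
    hence "shift i s \<alpha> \<in> bdry_nodes a b J i"
      using outer_neighbour_in_bdry_nodes(1)[where a = a and b = b and J = J, OF ab J \<alpha> s] by blast
    thus ?thesis using B[of "shift i s \<alpha>" i] M_nonneg by (simp add: B_lin_def)
  qed (rule D_bound)
  from this[of 1] this[of "-1"] D_bound[OF \<alpha>, of i]
  show "\<bar>D i (shift i 1 \<alpha>) - 2 * D i \<alpha> + D i (shift i (-1) \<alpha>)\<bar> \<le> 4 * M" by (simp add: abs_le_iff)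
qed

text \<open>The defect pairs up as \<open>(D\<^sub>+ - D) + (D\<^sub>- - D)\<close>. A difference towards an inner neighbour is
  bounded by the third derivative of \<open>u\<close> times the step, and towards a boundary neighbour it is \<open>0\<close> by
  \<open>B_quad\<close>.\<close>

lemma lap_defect_B_quad:
  assumes \<alpha>: "\<alpha> \<in> inner_nodes a b J"
    and B: "\<And>i \<beta>. \<beta> \<in> bdry_nodes a b J i \<Longrightarrow> B_quad a b J i V \<beta> = 0"
  shows "\<bar>lap_wide (step a b J) V \<alpha> - lap (step a b J) V \<alpha>\<bar> \<le> real CARD('n) * (M * mesh a b J)"
proof (rule lap_wide_minus_lap_le)
  fix i
  have h: "0 < step a b J i" using ab J by (rule step_pos)
  hence le: "M * step a b J i \<le> M * mesh a b J" "0 \<le> M * mesh a b J"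
    using M_nonneg step_le_mesh[of a b J i] by (auto intro!: mult_left_mono)
  have "\<bar>D i (shift i s \<alpha>) - D i \<alpha>\<bar> \<le> M * mesh a b J" if s: "s = 1 \<or> s = -1" for s
  proof (cases "shift i s \<alpha> \<in> inner_nodes a b J")
    case True
    thus ?thesis
      using s \<alpha> D_diff_bound[of \<alpha> i] D_diff_bound[of "shift i (-1) \<alpha>" i] le(1)
      by (auto simp: abs_minus_commute)
  next
    case False
    note out = outer_neighbour_in_bdry_nodes[where a = a and b = b and J = J, OF ab J \<alpha> s False]
    have "D i (shift i s \<alpha>) = D i \<alpha>" using B[OF out(1)] by (simp add: B_quad_def out(2))
    thus ?thesis using le(2) by simp
  qed
  from this[of 1] this[of "-1"] le(2)
  show "\<bar>D i (shift i 1 \<alpha>) - 2 * D i \<alpha> + D i (shift i (-1) \<alpha>)\<bar> \<le> 4 * (M * mesh a b J)" by (simp add: abs_le_iff)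
qed

lemma mesh_pos: "0 < mesh a b J"
  using step_pos[where a = a and b = b and J = J, OF ab J] step_le_mesh by (rule less_le_trans)

text \<open>The terms \<open>\<theta> u\<close> cancel. The factor \<open>2\<close> in the radius leaves room for the discrete gradient:
  the gradient has norm at most \<open>n M\<close> in dimension \<open>n\<close>, and the discretization error adds at most
  \<open>n M h\<^sup>2\<close>. As \<open>h < 1\<close>, higher powers of \<open>h\<close> are absorbed into \<open>h powr q\<close>.\<close>

lemma trunc_err_bound:
  assumes \<alpha>: "\<alpha> \<in> inner_nodes a b J" and mesh: "mesh a b J < 1"
    and lip: "\<And>q q'. norm q \<le> 2 * real CARD('n) * M \<Longrightarrow> norm q' \<le> 2 * real CARD('n) * M \<Longrightarrow>
      \<bar>H q (u (node a b J \<alpha>)) (node a b J \<alpha>) - H q' (u (node a b J \<alpha>)) (node a b J \<alpha>)\<bar> \<le> L * norm (q - q')"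
    and L: "0 \<le> L" and \<beta>: "0 \<le> \<beta>" and \<gamma>: "0 \<le> \<gamma>"
    and defect: "\<bar>lap_wide (step a b J) V \<alpha> - lap (step a b J) V \<alpha>\<bar> \<le> real CARD('n) * (M * mesh a b J powr r)"
    and q: "q \<le> 2" "q \<le> p + r"
  shows "\<bar>trunc_err \<beta> \<gamma> p \<theta> H a b J u V \<alpha>\<bar> \<le> real CARD('n) * M * (\<beta> + L + \<gamma>) * mesh a b J powr q"
proof -
  let ?x = "node a b J \<alpha>" and ?h = "mesh a b J" and ?N = "real CARD('n) * M"
  let ?lap = "lap (step a b J) V \<alpha>" and ?G = "grad_h (step a b J) V \<alpha>"
  let ?defect = "lap_wide (step a b J) V \<alpha> - ?lap"
  have h: "0 < ?h" by (rule mesh_pos)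
  have N: "0 \<le> ?N" using M_nonneg by simp
  have powr_le: "?h powr r' \<le> ?h powr q" if "q \<le> r'" for r'
    using that h mesh by (intro powr_mono') auto
  have h2: "?h\<^sup>2 \<le> ?h powr q" using powr_le[OF q(1)] h by simp
  have "V \<alpha> = u ?x" using \<alpha> by (intro samples) (simp add: inner_nodes_def)
  hence "trunc_err \<beta> \<gamma> p \<theta> H a b J u V \<alpha> =
      - (\<beta> * (?h\<^sup>2 * ?lap)) + (H ?G (u ?x) ?x - H (grad u ?x) (u ?x) ?x) + \<gamma> * (?h powr p * ?defect)"
    by (simp add: trunc_err_def H_hat_def Let_def)
  moreover have "\<bar>\<beta> * (?h\<^sup>2 * ?lap)\<bar> \<le> \<beta> * (?h powr q * ?N)"
    unfolding abs_mult using lap_bound[OF \<alpha>] h2 \<beta> h N by (intro mult_mono) auto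
  moreover have "\<bar>H ?G (u ?x) ?x - H (grad u ?x) (u ?x) ?x\<bar> \<le> L * (?N * ?h powr q)"
  proof -
    have e: "norm (?G - grad u ?x) \<le> ?N * ?h\<^sup>2" by (rule norm_grad_h_error[OF \<alpha>])
    have "?h\<^sup>2 \<le> 1" using h mesh by (simp add: power_le_one)
    hence "?N * ?h\<^sup>2 \<le> ?N * 1" using N by (intro mult_left_mono)
    hence "norm ?G \<le> 2 * ?N"
      using e norm_grad_le[OF \<alpha>] norm_triangle_sub[of ?G "grad u ?x"] by linarith
    hence "\<bar>H ?G (u ?x) ?x - H (grad u ?x) (u ?x) ?x\<bar> \<le> L * norm (?G - grad u ?x)"
      using norm_grad_le[OF \<alpha>] N by (intro lip) simp_all
    also have "\<dots> \<le> L * (?N * ?h\<^sup>2)" by (intro mult_left_mono e L)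
    also have "\<dots> \<le> L * (?N * ?h powr q)" by (intro mult_left_mono h2 N L)
    finally show ?thesis .
  qed
  moreover have "\<bar>\<gamma> * (?h powr p * ?defect)\<bar> \<le> \<gamma> * (?N * ?h powr q)"
  proof -
    have "\<bar>?h powr p * ?defect\<bar> \<le> ?h powr p * (real CARD('n) * (M * ?h powr r))"
      unfolding abs_mult using defect by (simp add: mult_left_mono)
    also have "\<dots> = ?N * ?h powr (p + r)" by (simp add: powr_add mult_ac)
    also have "\<dots> \<le> ?N * ?h powr q" by (intro mult_left_mono powr_le q N)
    finally show ?thesis using \<gamma> by (simp add: abs_mult mult_left_mono)
  qed
  ultimately have "\<bar>trunc_err \<beta> \<gamma> p \<theta> H a b J u V \<alpha>\<bar> \<le>
      \<beta> * (?h powr q * ?N) + L * (?N * ?h powr q) + \<gamma> * (?N * ?h powr q)" by linarith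
  also have "\<dots> = ?N * (\<beta> + L + \<gamma>) * ?h powr q" by (simp add: distrib_left distrib_right mult_ac)
  finally show ?thesis .
qed

end

section \<open>Orders of the local truncation error\<close>

theorem lemma3p1:
  fixes a b :: "real ^ 'n::finite"
    and \<theta> \<gamma> \<beta> p :: real
    and g :: "real ^ 'n \<Rightarrow> real"
    and H :: "real ^ 'n \<Rightarrow> real \<Rightarrow> real ^ 'n \<Rightarrow> real"
    and u :: "real ^ 'n \<Rightarrow> real"
  assumes "\<And>i. a $ i < b $ i"
    and "\<theta> > 0"
    and "continuous_on (frontier (box a b)) g"
    and "locally_lipschitz_on (UNIV \<times> UNIV \<times> closure (box a b)) (\<lambda>(q, v, x). H q v x)"
    and "\<And>q x. x \<in> closure (box a b) \<Longrightarrow> mono (\<lambda>v. H q v x)"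
    and "\<gamma> > 0" and "\<beta> \<ge> 0" and "0 \<le> p" and "p \<le> 1"
    and "C_closure 5 (box a b) u"
    and "\<And>x. x \<in> frontier (box a b) \<Longrightarrow> u x = g x"
  shows "(\<forall>B. trunc_err_order \<beta> \<gamma> p \<theta> H a b B u (interior_grid a b) 2)
    \<and> trunc_err_order \<beta> \<gamma> p \<theta> H a b (B_lin a b) u
        (\<lambda>J. inner_nodes a b J - interior_grid a b J) p
    \<and> trunc_err_order \<beta> \<gamma> p \<theta> H a b (B_quad a b) u
        (\<lambda>J. inner_nodes a b J - interior_grid a b J) (p + 1)"
proof -
  note ab = assms(1)
  let ?n = "real CARD('n)"
  have cl: "closure (box a b) = cbox a b" using box_nonempty_cart[OF ab] by simp
  have "\<exists>d. d 0 = u \<and> (\<forall>m\<le>5. continuous_on (cbox a b) (d m)) \<and>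
    (\<forall>m<5. \<forall>x\<in>box a b. ((\<lambda>t. d m (x + t *\<^sub>R axis i 1)) has_real_derivative d (Suc m) x) (at 0))"
    for i using C_closure_derivs[OF assms(10), of i] unfolding cl .
  then obtain d where d: "\<And>i. d i 0 = u \<and> (\<forall>m\<le>5. continuous_on (cbox a b) (d i m)) \<and>
    (\<forall>m<5. \<forall>x\<in>box a b. ((\<lambda>t. d i m (x + t *\<^sub>R axis i 1)) has_real_derivative d i (Suc m) x) (at 0))"
    by metis
  \<comment> \<open>The bound \<open>M\<close> depends on \<open>u\<close> only, hence so do the radius \<open>2 n M\<close> and the Lipschitz constant \<open>L\<close>
    below (given \<open>H\<close>): this is what makes the final constant uniform in the grid and the node.\<close>
  have "bounded (\<Union>i. \<Union>m\<in>{..4}. d i m ` cbox a b)"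
    using d by (intro bounded_UN ballI finite finite_atMost compact_imp_bounded compact_continuous_image compact_cbox) auto
  then obtain M where "\<forall>y\<in>(\<Union>i. \<Union>m\<in>{..4}. d i m ` cbox a b). norm y \<le> M"
    by (auto simp: bounded_iff)
  hence M: "\<bar>d i m x\<bar> \<le> M" if "m \<le> 4" "x \<in> cbox a b" for i m x
    using that by fastforce
  have sampled: "sampled_function a b J u V d M" if "\<forall>i. 2 \<le> J i" "inserted a b J B u V" for J V B
    using that d ab M by unfold_locales (auto simp: inserted_def)
  obtain L where L: "0 \<le> L"
    and lip: "\<And>t q q'. t \<in> cball 0 M \<times> cbox a b \<Longrightarrow> q \<in> cball 0 (2 * ?n * M) \<Longrightarrow>
      q' \<in> cball 0 (2 * ?n * M) \<Longrightarrow>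
      dist (case (q, t) of (q, v, x) \<Rightarrow> H q v x) (case (q', t) of (q, v, x) \<Rightarrow> H q v x) \<le> L * dist q q'"
    by (rule locally_lipschitz_on_first_uniform[OF assms(4), of "cball 0 (2 * ?n * M)" "cball 0 M \<times> cbox a b"])
      (use cl in \<open>auto simp: compact_Times\<close>)
  have lip: "\<bar>H q (u x) x - H q' (u x) x\<bar> \<le> L * norm (q - q')"
    if "x \<in> cbox a b" "norm q \<le> 2 * ?n * M" "norm q' \<le> 2 * ?n * M" for x q q'
    using lip[of "(u x, x)" q q'] M[of 0 x] d that by (simp add: dist_real_def dist_norm)
  \<comment> \<open>The three parts differ only in the power \<open>r\<close> of the mesh size that bounds the Laplacian defect.\<close>
  have order: "trunc_err_order \<beta> \<gamma> p \<theta> H a b B u N q"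
    if q: "q \<le> 2" "q \<le> p + r" and N: "\<And>J. N J \<subseteq> inner_nodes a b J"
      and defect: "\<And>J V \<alpha>. sampled_function a b J u V d M \<Longrightarrow> inserted a b J B u V \<Longrightarrow> \<alpha> \<in> N J \<Longrightarrow>
        \<bar>lap_wide (step a b J) V \<alpha> - lap (step a b J) V \<alpha>\<bar> \<le> ?n * (M * mesh a b J powr r)"
    for B N q r
    unfolding trunc_err_order_def
  proof (rule exI[of _ "?n * M * (\<beta> + L + \<gamma>)"], rule exI[of _ 1], intro conjI allI impI ballI)
    fix J V \<alpha>
    assume "\<forall>i. 2 \<le> J i" and mesh: "mesh a b J < 1" and V: "inserted a b J B u V" and \<alpha>: "\<alpha> \<in> N J"
    then interpret sampled_function a b J u V d M using sampled by blast
    have inner: "\<alpha> \<in> inner_nodes a b J" using N \<alpha> by blast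
    hence x: "node a b J \<alpha> \<in> cbox a b" using box_subset_cbox[of a b] by (auto simp: inner_nodes_def)
    show "\<bar>trunc_err \<beta> \<gamma> p \<theta> H a b J u V \<alpha>\<bar> \<le> ?n * M * (\<beta> + L + \<gamma>) * mesh a b J powr q"
      by (rule trunc_err_bound[where H = H, OF inner mesh _ L assms(7) less_imp_le[OF assms(6)]
            defect[OF sampled_function_axioms V \<alpha>] q]) (rule lip[OF x])
  qed simp
  have "trunc_err_order \<beta> \<gamma> p \<theta> H a b B u (interior_grid a b) 2" for B
  proof (rule order[where r = 2])
    show "\<bar>lap_wide (step a b J) V \<alpha> - lap (step a b J) V \<alpha>\<bar> \<le> ?n * (M * mesh a b J powr 2)"
      if "sampled_function a b J u V d M" "\<alpha> \<in> interior_grid a b J" for J V \<alpha>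
      using sampled_function.lap_defect_interior[OF that] sampled_function.mesh_pos[OF that(1)] by simp
  qed (use \<open>0 \<le> p\<close> in \<open>auto simp: interior_grid_def\<close>)
  moreover have "trunc_err_order \<beta> \<gamma> p \<theta> H a b (B_lin a b) u
      (\<lambda>J. inner_nodes a b J - interior_grid a b J) p"
  proof (rule order[where r = 0])
    show "\<bar>lap_wide (step a b J) V \<alpha> - lap (step a b J) V \<alpha>\<bar> \<le> ?n * (M * mesh a b J powr 0)"
      if "sampled_function a b J u V d M" "inserted a b J (B_lin a b) u V"
        "\<alpha> \<in> inner_nodes a b J - interior_grid a b J" for J V \<alpha>
      using sampled_function.lap_defect_B_lin[OF that(1), of \<alpha>] sampled_function.mesh_pos[OF that(1)] that(2,3)
      by (simp add: inserted_def)
  qed (use \<open>p \<le> 1\<close> in auto)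
  moreover have "trunc_err_order \<beta> \<gamma> p \<theta> H a b (B_quad a b) u
      (\<lambda>J. inner_nodes a b J - interior_grid a b J) (p + 1)"
  proof (rule order[where r = 1])
    show "\<bar>lap_wide (step a b J) V \<alpha> - lap (step a b J) V \<alpha>\<bar> \<le> ?n * (M * mesh a b J powr 1)"
      if "sampled_function a b J u V d M" "inserted a b J (B_quad a b) u V"
        "\<alpha> \<in> inner_nodes a b J - interior_grid a b J" for J V \<alpha>
      using sampled_function.lap_defect_B_quad[OF that(1), of \<alpha>] sampled_function.mesh_pos[OF that(1)] that(2,3)
      by (simp add: inserted_def)
  qed (use \<open>p \<le> 1\<close> in auto)
  ultimately show ?thesis by blast
qed

end
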